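(* Let $(P,<)$ be a finite poset, $P^*\subset P$ a subset containing all minimal and maximal elements of $(P,<)$, $\lambda\in\mathbb Z^{P^*}$ a dominant marking, and $C\sqcup O=P\setminus P^*$ a partition. Let $<'$ be the order on $P$ such that $p<'q$ if and only if $p<q$ and $p\notin P^*\cup O$. Then $\mathcal O_{C,O}(P,<,\lambda)=\mathcal R_\lambda(P,<,<')$.
   Context: A marking $\lambda\in\mathbb Z^{P^*}$ is dominant if $\lambda_p\ge\lambda_q$ for all $p<q$ in $P^*$. The marked chain-order polytope $\mathcal O_{C,O}(P,<,\lambda)\subset\mathbb R^P$ consists of the points $x$ such that: (1) $x_p=\lambda_p$ for all $p\in P^*$; (2) $x_p\ge0$ for all $p\in C$; (3) for every chain $a<p_1<\dots<p_r<b$ ($r\ge0$) with $a,b\in P^*\sqcup O$ and all $p_i\in C$, one has $x_{p_1}+\dots+x_{p_r}\le x_a-x_b$. $\mathcal J=\mathcal J(P,<)$ is the set of order ideals (lower sets). $\max_{<'}A$ is the set of $<'$-maximal elements of $A$; $\mathbf 1_A$ the indicator vector. Marked relative poset polytope: for $K\in\mathcal J(P^*,<)$ put $\omega_K=\mathbf 1_K\in\mathbb R^{P^*}$ and let $\mathcal R_{\omega_K}(P,<,<')\subset\mathbb R^P$ be the convex hull of $\mathbf 1_{\max_{<'}J}$ over $J\in\mathcal J$ with $J\cap P^*=K$. If $\lambda$ is dominant with nonnegative coordinates there is a unique expression $\lambda=\sum_{K}\alpha_K(\lambda)\omega_K$ with $\alpha_K(\lambda)\in\mathbb Z_{\ge0}$,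 $\alpha_\varnothing(\lambda)=0$ and $\{K:\alpha_K(\lambda)>0\}$ a chain; then $\mathcal R_\lambda(P,<,<')$ is the Minkowski sum $\sum_K\alpha_K(\lambda)\mathcal R_{\omega_K}(P,<,<')$. In general $\mathcal R_\lambda(P,<,<')=\mathcal R_{\lambda+\beta\omega_{P^*}}(P,<,<')-\beta\mathbf 1_{\max_{<'}P}$ for any integer $\beta$ making $\lambda+\beta\omega_{P^*}$ nonnegative. (The definition of $\mathcal R_\lambda(P,<,<')$ in general requires that $<'$ is weaker than $<$, that $\mathcal J(P,<)$ is closed under the operation sending $J_1,J_2$ to the order ideal of $(P,<')$ generated by $(J_1\cap J_2)\cap(\max_{<'}J_1\cup\max_{<'}J_2)$, and that no marked $p$ satisfies $p<'q$; these hold for the present $<'$.) *)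

theory Defs
  imports "HOL-Analysis.Analysis"
begin

text \<open>
  A finite poset is a carrier \<open>P\<close> inside a finite type \<open>'a\<close> with a strict order \<open>lt\<close>, of which
  only the restriction to \<open>P\<close> matters.  The space of real vectors indexed by \<open>P\<close> is the
  coordinate subspace of \<open>real ^ 'a\<close> of those vectors that vanish outside \<open>P\<close>.
  (With \<open>P = UNIV\<close> as the only choice, the empty poset would be excluded.)
\<close>

definition minimal_elems :: "('a \<Rightarrow> 'a \<Rightarrow> bool) \<Rightarrow> 'a set \<Rightarrow> 'a set" where
  "minimal_elems lt A = {p \<in> A. \<not> (\<exists>q\<in>A. lt q p)}"

definition maximal_elems :: "('a \<Rightarrow> 'a \<Rightarrow> bool) \<Rightarrow> 'a set \<Rightarrow> 'a set" where
  "maximal_elems lt A = {p \<in> A. \<not> (\<exists>q\<in>A. lt p q)}"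

definition order_ideals :: "'a set \<Rightarrow> ('a \<Rightarrow> 'a \<Rightarrow> bool) \<Rightarrow> 'a set set" where
  "order_ideals A lt = {J. J \<subseteq> A \<and> (\<forall>q\<in>J. \<forall>p\<in>A. lt p q \<longrightarrow> p \<in> J)}"

definition indicator_vec :: "'a set \<Rightarrow> real ^ 'a::finite" where
  "indicator_vec A = (\<chi> p. indicator A p)"

text \<open>
  Markings are functions \<open>'a \<Rightarrow> int\<close> whose values outside the set \<open>M\<close> of marked elements are
  irrelevant.
\<close>

definition dominant :: "('a \<Rightarrow> 'a \<Rightarrow> bool) \<Rightarrow> 'a set \<Rightarrow> ('a \<Rightarrow> int) \<Rightarrow> bool" where
  "dominant lt M lam \<longleftrightarrow> (\<forall>p\<in>M. \<forall>q\<in>M. lt p q \<longrightarrow> lam q \<le> lam p)"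

definition marked_chain_order_polytope ::
    "'a::finite set \<Rightarrow> ('a \<Rightarrow> 'a \<Rightarrow> bool) \<Rightarrow> 'a set \<Rightarrow> 'a set \<Rightarrow> 'a set \<Rightarrow> ('a \<Rightarrow> int) \<Rightarrow> (real ^ 'a) set"
  where
  "marked_chain_order_polytope P lt M C Om lam =
     {x. (\<forall>p. p \<notin> P \<longrightarrow> x $ p = 0) \<and>
         (\<forall>p\<in>M. x $ p = of_int (lam p)) \<and>
         (\<forall>p\<in>C. 0 \<le> x $ p) \<and>
         (\<forall>a \<in> M \<union> Om. \<forall>b \<in> M \<union> Om. \<forall>ps.
            set ps \<subseteq> C \<and> sorted_wrt lt (a # ps @ [b]) \<longrightarrow>
            (\<Sum>p\<leftarrow>ps. x $ p) \<le> x $ a - x $ b)}"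

definition fundamental_relative_poset_polytope ::
    "'a::finite set \<Rightarrow> ('a \<Rightarrow> 'a \<Rightarrow> bool) \<Rightarrow> ('a \<Rightarrow> 'a \<Rightarrow> bool) \<Rightarrow> 'a set \<Rightarrow> 'a set \<Rightarrow> (real ^ 'a) set"
  where
  "fundamental_relative_poset_polytope P lt lt' M K =
     convex hull {indicator_vec (maximal_elems lt' J) | J. J \<in> order_ideals P lt \<and> J \<inter> M = K}"

definition is_ideal_decomposition ::
    "('a \<Rightarrow> 'a \<Rightarrow> bool) \<Rightarrow> 'a set \<Rightarrow> ('a \<Rightarrow> int) \<Rightarrow> ('a set \<Rightarrow> nat) \<Rightarrow> bool"
  where
  "is_ideal_decomposition lt M lam \<alpha> \<longleftrightarrow>
     (\<forall>K. K \<notin> order_ideals M lt \<longrightarrow> \<alpha> K = 0) \<and>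
     (\<forall>p\<in>M. lam p = (\<Sum>K\<in>order_ideals M lt. int (\<alpha> K) * indicator K p)) \<and>
     \<alpha> {} = 0 \<and>
     chain_subset {K. \<alpha> K > 0}"

text \<open>Meaningful for dominant nonnegative \<open>lam\<close>, where the decomposition exists and is unique.\<close>

definition ideal_coeff :: "('a \<Rightarrow> 'a \<Rightarrow> bool) \<Rightarrow> 'a set \<Rightarrow> ('a \<Rightarrow> int) \<Rightarrow> 'a set \<Rightarrow> nat" where
  "ideal_coeff lt M lam = (THE \<alpha>. is_ideal_decomposition lt M lam \<alpha>)"

text \<open>The outer sum is the Minkowski sum, i.e. the sum in the additive monoid of sets.\<close>

definition nonneg_relative_poset_polytope ::
    "'a::finite set \<Rightarrow> ('a \<Rightarrow> 'a \<Rightarrow> bool) \<Rightarrow> ('a \<Rightarrow> 'a \<Rightarrow> bool) \<Rightarrow> 'a set \<Rightarrow> ('a \<Rightarrow> int) \<Rightarrow> (real ^ 'a) set"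
  where
  "nonneg_relative_poset_polytope P lt lt' M lam =
     (\<Sum>K\<in>order_ideals M lt.
        (\<lambda>x. real (ideal_coeff lt M lam K) *\<^sub>R x) ` fundamental_relative_poset_polytope P lt lt' M K)"

text \<open>
  The definition is by the common value over \<^emph>\<open>all\<close> integers \<open>\<beta>\<close> that make the shifted marking
  nonnegative; for a nonnegative marking \<open>\<beta> = 0\<close> is one of them, so that case is subsumed.
\<close>

definition relative_poset_polytope ::
    "'a::finite set \<Rightarrow> ('a \<Rightarrow> 'a \<Rightarrow> bool) \<Rightarrow> ('a \<Rightarrow> 'a \<Rightarrow> bool) \<Rightarrow> 'a set \<Rightarrow> ('a \<Rightarrow> int) \<Rightarrow> (real ^ 'a) set"
  where
  "relative_poset_polytope P lt lt' M lam =
     (THE R. \<forall>\<beta>::int. (\<forall>p\<in>M. 0 \<le> lam p + \<beta> * indicator M p) \<longrightarrow>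
        R = (\<lambda>x. x - of_int \<beta> *\<^sub>R indicator_vec (maximal_elems lt' P)) `
              nonneg_relative_poset_polytope P lt lt' M (\<lambda>p. lam p + \<beta> * indicator M p))"

end

theory Submission
  imports Defs
begin

text \<open>
  A point \<open>y\<close> of the marked chain-order polytope is \<open>y p = x p - max {x q | q > p}\<close> on \<open>C\<close> and
  \<open>y = x\<close> elsewhere, for a unique order-reversing \<open>x\<close>.  For \<open>x\<close> the indicator of an order ideal
  \<open>J\<close>, this \<open>y\<close> is the indicator of the \<open>lt'\<close>-maximal elements of \<open>J\<close>.  A nonnegative \<open>x\<close> is a
  positive combination of indicators of its superlevel sets, and the piecewise linear map
  \<open>x \<mapsto> y\<close> is linear on such a combination; grouping the levels by their trace on the marked
  elements places \<open>y\<close> in the Minkowski sum.  Conversely, the chain-order polytopes are convex and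
  superadditive in the marking, so they contain the Minkowski sum of the fundamental polytopes.
\<close>

section \<open>Decomposing a marking along a chain of order ideals\<close>

lemma order_ideals_subset: "J \<in> order_ideals A lt \<Longrightarrow> J \<subseteq> A"
  by (simp add: order_ideals_def)

lemma order_ideals_down: "J \<in> order_ideals A lt \<Longrightarrow> q \<in> J \<Longrightarrow> p \<in> A \<Longrightarrow> lt p q \<Longrightarrow> p \<in> J"
  by (auto simp: order_ideals_def)

text \<open>Coefficients and values are real because \<open>transfer_decomposition\<close> peels off
  multiples given by values at unmarked elements, which need not be integers.\<close>

definition real_ideal_decomposition ::
    "('a \<Rightarrow> 'a \<Rightarrow> bool) \<Rightarrow> 'a set \<Rightarrow> ('a \<Rightarrow> real) \<Rightarrow> ('a set \<Rightarrow> real) \<Rightarrow> bool" where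
  "real_ideal_decomposition lt M l \<alpha> \<longleftrightarrow>
     (\<forall>K. 0 \<le> \<alpha> K) \<and>
     (\<forall>K. K \<notin> order_ideals M lt \<longrightarrow> \<alpha> K = 0) \<and>
     (\<forall>p\<in>M. l p = (\<Sum>K\<in>order_ideals M lt. \<alpha> K * indicator K p)) \<and>
     \<alpha> {} = 0 \<and>
     chain_subset {K. \<alpha> K > 0}"

lemma is_ideal_decomposition_real:
  fixes M :: "'a::finite set"
  assumes "is_ideal_decomposition lt M lam \<alpha>"
  shows "real_ideal_decomposition lt M (\<lambda>p. of_int (lam p)) (\<lambda>K. real (\<alpha> K))"
proof -
  have "real_of_int (lam p) = (\<Sum>K\<in>order_ideals M lt. real (\<alpha> K) * indicator K p)" if "p \<in> M" for p
  proof -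
    have "real_of_int (lam p) = real_of_int (\<Sum>K\<in>order_ideals M lt. int (\<alpha> K) * indicator K p)"
      using assms that by (simp add: is_ideal_decomposition_def)
    also have "\<dots> = (\<Sum>K\<in>order_ideals M lt. real (\<alpha> K) * indicator K p)"
      by (simp add: indicator_def of_bool_def if_distrib cong: if_cong)
    finally show ?thesis .
  qed
  with assms show ?thesis
    by (simp add: is_ideal_decomposition_def real_ideal_decomposition_def)
qed

lemma real_ideal_decomposition_le:
  fixes M :: "'a::finite set"
  assumes d: "real_ideal_decomposition lt M l \<alpha>" and "p \<in> K" "p \<in> M"
  shows "\<alpha> K \<le> l p"
proof (cases "K \<in> order_ideals M lt")
  case True
  have "\<alpha> K = \<alpha> K * indicator K p" using assms by simp
  also have "\<dots> \<le> (\<Sum>K\<in>order_ideals M lt. \<alpha> K * indicator K p)"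
    using d by (intro member_le_sum True) (auto simp: real_ideal_decomposition_def)
  also have "\<dots> = l p" using assms by (simp add: real_ideal_decomposition_def)
  finally show ?thesis .
next
  case False
  then have "\<alpha> K = 0" using d by (simp add: real_ideal_decomposition_def)
  moreover have "0 \<le> l p"
    using d \<open>p \<in> M\<close> by (auto simp: real_ideal_decomposition_def intro!: sum_nonneg)
  ultimately show ?thesis by simp
qed

text \<open>The support \<open>K\<close> of \<open>l\<close> is the largest ideal of the chain. Some
  element of \<open>K\<close> lies in no other ideal with positive coefficient, so only
  \<open>\<alpha> K\<close> contributes to \<open>l\<close> there. Thus \<open>l\<close> alone
  determines the coefficient of the top ideal.\<close>

lemma real_ideal_decomposition_top:
  fixes M :: "'a::finite set"
  assumes d: "real_ideal_decomposition lt M l \<alpha>" and ne: "{p \<in> M. 0 < l p} \<noteq> {}"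
  shows "\<exists>p\<in>M. 0 < l p \<and> l p = \<alpha> {p \<in> M. 0 < l p}"
proof -
  define K where "K = {p \<in> M. 0 < l p}"
  let ?S = "{L. 0 < \<alpha> L}"
  have ideals: "L \<in> order_ideals M lt" if "L \<in> ?S" for L
    using d that by (auto simp: real_ideal_decomposition_def)
  have sub: "L \<subseteq> K" if "L \<in> ?S" for L
  proof
    fix p assume "p \<in> L"
    then have "p \<in> M" using ideals[OF that] by (auto simp: order_ideals_def)
    with real_ideal_decomposition_le[OF d \<open>p \<in> L\<close>] that show "p \<in> K" by (auto simp: K_def)
  qed
  have cover: "\<exists>L\<in>?S. p \<in> L" if "p \<in> K" for p
  proof (rule ccontr)
    assume "\<not> ?thesis"
    then have "\<alpha> L * indicator L p = 0" for L
      using d by (force simp: real_ideal_decomposition_def indicator_def less_le)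
    then have "(\<Sum>L\<in>order_ideals M lt. \<alpha> L * indicator L p) = 0"
      by (intro sum.neutral) blast
    then have "l p = 0" using d that by (simp add: real_ideal_decomposition_def K_def)
    with that show False by (simp add: K_def)
  qed
  have "\<exists>p\<in>K. \<forall>L\<in>?S. p \<in> L \<longrightarrow> L = K"
  proof (rule ccontr)
    assume *: "\<not> ?thesis"
    \<comment> \<open>Otherwise the members of the chain other than \<open>K\<close> cover
      \<open>K\<close>. A nonempty finite chain contains its union, so \<open>K\<close> would be one
      of these other members.\<close>
    let ?T = "?S - {K}"
    have "?T \<noteq> {}" using * ne by (auto simp: K_def)
    moreover have "subset.chain UNIV ?T"
      using d by (auto simp: real_ideal_decomposition_def chain_subset_def subset_chain_def)
    ultimately have "\<Union>?T \<in> ?T"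
      by (intro Union_in_chain) auto
    moreover have "\<Union>?T = K" using * sub by blast
    ultimately show False by blast
  qed
  then obtain p where p: "p \<in> K" "\<And>L. L \<in> ?S \<Longrightarrow> p \<in> L \<Longrightarrow> L = K" by blast
  have K: "K \<in> order_ideals M lt" using cover[OF p(1)] p(2) ideals by blast
  have "l p = (\<Sum>L\<in>order_ideals M lt. \<alpha> L * indicator L p)"
    using d p by (simp add: real_ideal_decomposition_def K_def)
  also have "\<dots> = (\<Sum>L\<in>order_ideals M lt. if L = K then \<alpha> K else 0)"
  proof (rule sum.cong)
    fix L
    have "0 \<le> \<alpha> L" using d by (simp add: real_ideal_decomposition_def)
    then show "\<alpha> L * indicator L p = (if L = K then \<alpha> K else 0)"
      using p(1) p(2)[of L] by (cases "p \<in> L") auto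
  qed simp
  also have "\<dots> = \<alpha> K" using K by simp
  finally show ?thesis using p(1) unfolding K_def by blast
qed

text \<open>The single peeling step shared by the uniqueness proof and by
  \<open>transfer_decomposition\<close>. Lowering one coefficient can only shrink the set of
  positive ones, so the chain condition survives.\<close>

lemma real_ideal_decomposition_diff:
  fixes M :: "'a::finite set"
  assumes d: "real_ideal_decomposition lt M l \<alpha>" and "0 \<le> v" "v \<le> \<alpha> K"
    and K: "K \<in> order_ideals M lt" "K \<noteq> {}"
  shows "real_ideal_decomposition lt M (\<lambda>p. l p - v * indicator K p) (\<alpha>(K := \<alpha> K - v))"
proof -
  have "l p - v * indicator K p = (\<Sum>L\<in>order_ideals M lt. (\<alpha>(K := \<alpha> K - v)) L * indicator L p)"
    if "p \<in> M" for p
  proof -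
    have "(\<Sum>L\<in>order_ideals M lt. (\<alpha>(K := \<alpha> K - v)) L * indicator L p) =
       (\<Sum>L\<in>order_ideals M lt. \<alpha> L * indicator L p - (if L = K then v * indicator K p else 0))"
      by (rule sum.cong) (auto simp: algebra_simps)
    also have "\<dots> = l p - v * indicator K p"
      using K d that by (simp add: sum_subtractf real_ideal_decomposition_def)
    finally show ?thesis by simp
  qed
  moreover have "chain_subset {L. (\<alpha>(K := \<alpha> K - v)) L > 0}"
  proof -
    have "{L. (\<alpha>(K := \<alpha> K - v)) L > 0} \<subseteq> {L. \<alpha> L > 0}"
      using \<open>0 \<le> v\<close> by (auto split: if_splits)
    then show ?thesis using d unfolding real_ideal_decomposition_def chain_subset_def by blast
  qed
  ultimately show ?thesis using assms by (simp add: real_ideal_decomposition_def)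
qed

text \<open>In both decompositions the coefficient of the support \<open>K\<close> is a lower bound
  of \<open>l\<close> on \<open>K\<close> that is attained, so it is the minimum of \<open>l\<close>
  on \<open>K\<close>. Subtracting it removes the minimising elements from the support, and
  induction on the size of the support applies.\<close>

lemma real_ideal_decomposition_unique:
  fixes M :: "'a::finite set"
  assumes "real_ideal_decomposition lt M l \<alpha>" "real_ideal_decomposition lt M l \<beta>"
  shows "\<alpha> = \<beta>"
  using assms
proof (induction "card {p \<in> M. 0 < l p}" arbitrary: l \<alpha> \<beta> rule: less_induct)
  case less
  define K where "K = {p \<in> M. 0 < l p}"
  have zero: "\<gamma> L = 0" if "real_ideal_decomposition lt M l \<gamma>" "K = {}" for \<gamma> L
  proof (cases "L \<in> order_ideals M lt \<and> L \<noteq> {}")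
    case True
    then obtain p where "p \<in> L" "p \<in> M" by (auto simp: order_ideals_def)
    then have "\<gamma> L \<le> l p" by (intro real_ideal_decomposition_le[OF that(1)])
    also have "l p \<le> 0" using \<open>p \<in> M\<close> that(2) by (auto simp: K_def not_less)
    finally show ?thesis using that(1) by (simp add: real_ideal_decomposition_def antisym)
  qed (use that(1) in \<open>auto simp: real_ideal_decomposition_def\<close>)
  show ?case
  proof (cases "K = {}")
    case True
    then show ?thesis using zero less.prems by (intro ext) metis
  next
    case False
    obtain p where p: "p \<in> M" "0 < l p" "l p = \<alpha> K"
      using real_ideal_decomposition_top[OF less.prems(1)] False by (auto simp: K_def)
    obtain q where q: "q \<in> M" "0 < l q" "l q = \<beta> K"
      using real_ideal_decomposition_top[OF less.prems(2)] False by (auto simp: K_def)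
    have pq: "p \<in> K" "q \<in> K" using p q by (auto simp: K_def)
    have eq: "\<alpha> K = \<beta> K"
      using real_ideal_decomposition_le[OF less.prems(1) pq(2) q(1)]
        real_ideal_decomposition_le[OF less.prems(2) pq(1) p(1)] p q by simp
    have K: "K \<in> order_ideals M lt"
      using less.prems(1) p by (metis less_irrefl real_ideal_decomposition_def)
    let ?l = "\<lambda>p. l p - \<alpha> K * indicator K p"
    have "{p \<in> M. 0 < ?l p} \<subseteq> K - {p}"
      using p pq by (auto simp: K_def indicator_def split: if_splits)
    then have "{p \<in> M. 0 < ?l p} \<subset> K" using pq by blast
    then have "card {p \<in> M. 0 < ?l p} < card K" by (intro psubset_card_mono) auto
    moreover have "real_ideal_decomposition lt M ?l (\<alpha>(K := 0))"
      using real_ideal_decomposition_diff[OF less.prems(1) _ order.refl K False] p by simp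
    moreover have "real_ideal_decomposition lt M ?l (\<beta>(K := 0))"
      using real_ideal_decomposition_diff[OF less.prems(2) _ order.refl K False] p eq by simp
    ultimately have "\<alpha>(K := 0) = \<beta>(K := 0)"
      by (rule less.hyps[folded K_def])
    then show ?thesis using eq by (metis fun_upd_triv fun_upd_upd)
  qed
qed

text \<open>Subtracting the indicator of the support keeps the marking dominant and nonnegative and
  lowers the sum of its values, on which the induction runs.\<close>

lemma ideal_decomposition_exists:
  fixes M :: "'a::finite set"
  assumes "dominant lt M lam" "\<And>p. p \<in> M \<Longrightarrow> 0 \<le> lam p"
  shows "\<exists>\<alpha>. is_ideal_decomposition lt M lam \<alpha>"
  using assms
proof (induction "\<Sum>p\<in>M. nat (lam p)" arbitrary: lam rule: less_induct)
  case less
  define K where "K = {p \<in> M. 0 < lam p}"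
  show ?case
  proof (cases "K = {}")
    case True
    then have "lam p = 0" if "p \<in> M" for p
      using less.prems(2)[OF that] that by (force simp: K_def)
    then have "is_ideal_decomposition lt M lam (\<lambda>_. 0)"
      by (auto simp: is_ideal_decomposition_def chain_subset_def)
    then show ?thesis by blast
  next
    case False
    have K: "K \<in> order_ideals M lt"
      using less.prems by (fastforce simp: order_ideals_def dominant_def K_def)
    define lam' where "lam' = (\<lambda>p. lam p - indicator K p)"
    obtain k where k: "k \<in> M" "0 < lam k" using False by (auto simp: K_def)
    have "(\<Sum>p\<in>M. nat (lam' p)) < (\<Sum>p\<in>M. nat (lam p))"
      using k by (intro sum_strict_mono_ex1) (auto simp: lam'_def K_def indicator_def)
    moreover have nn: "0 \<le> lam' p" if "p \<in> M" for p
      using less.prems(2)[OF that] that by (auto simp: lam'_def K_def indicator_def)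
    moreover have "dominant lt M lam'"
      unfolding dominant_def
    proof (intro ballI impI)
      fix p q assume pq: "p \<in> M" "q \<in> M" "lt p q"
      then have le: "lam q \<le> lam p" using less.prems(1) by (auto simp: dominant_def)
      show "lam' q \<le> lam' p"
        using le nn[OF pq(1)] pq less.prems(2)[OF pq(2)]
        by (auto simp: lam'_def K_def indicator_def split: if_splits)
    qed
    ultimately obtain \<alpha> where \<alpha>: "is_ideal_decomposition lt M lam' \<alpha>"
      using less.hyps by blast
    \<comment> \<open>Every ideal used for \<open>lam'\<close> lies in the support of
      \<open>lam'\<close>, hence in \<open>K\<close>. So adding \<open>K\<close> to these ideals
      leaves a chain.\<close>
    have sub: "L \<subseteq> K" if "\<alpha> L > 0" for L
    proof
      fix p assume "p \<in> L"
      have "L \<in> order_ideals M lt" using \<alpha> that by (auto simp: is_ideal_decomposition_def)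
      then have "p \<in> M" using \<open>p \<in> L\<close> by (auto simp: order_ideals_def)
      then show "p \<in> K"
        using real_ideal_decomposition_le[OF is_ideal_decomposition_real[OF \<alpha>] \<open>p \<in> L\<close>] that
          less.prems(2)[OF \<open>p \<in> M\<close>]
        by (cases "0 < lam p") (auto simp: lam'_def K_def indicator_def)
    qed
    have "is_ideal_decomposition lt M lam (\<alpha>(K := \<alpha> K + 1))"
      unfolding is_ideal_decomposition_def
    proof (intro conjI)
      show "\<forall>p\<in>M. lam p = (\<Sum>L\<in>order_ideals M lt. int ((\<alpha>(K := \<alpha> K + 1)) L) * indicator L p)"
      proof
        fix p assume "p \<in> M"
        have "(\<Sum>L\<in>order_ideals M lt. int ((\<alpha>(K := \<alpha> K + 1)) L) * indicator L p) =
          (\<Sum>L\<in>order_ideals M lt. int (\<alpha> L) * indicator L p + (if L = K then indicator K p else 0))"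
          by (rule sum.cong) (auto simp: algebra_simps)
        also have "\<dots> = lam' p + indicator K p"
          using K \<alpha> \<open>p \<in> M\<close> by (simp add: sum.distrib is_ideal_decomposition_def)
        finally show "lam p = (\<Sum>L\<in>order_ideals M lt. int ((\<alpha>(K := \<alpha> K + 1)) L) * indicator L p)"
          by (simp add: lam'_def)
      qed
      show "chain_subset {L. (\<alpha>(K := \<alpha> K + 1)) L > 0}"
        using \<alpha> sub by (auto simp: is_ideal_decomposition_def chain_subset_def split: if_splits)
    qed (use \<alpha> K False in \<open>auto simp: is_ideal_decomposition_def\<close>)
    then show ?thesis by blast
  qed
qed

lemma is_ideal_decomposition_ideal_coeff:
  fixes M :: "'a::finite set"
  assumes "dominant lt M lam" "\<And>p. p \<in> M \<Longrightarrow> 0 \<le> lam p"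
  shows "is_ideal_decomposition lt M lam (ideal_coeff lt M lam)"
  unfolding ideal_coeff_def
proof (rule theI'[of "is_ideal_decomposition lt M lam"])
  show "\<exists>!\<alpha>. is_ideal_decomposition lt M lam \<alpha>"
  proof (rule ex_ex1I)
    fix \<alpha> \<beta> assume "is_ideal_decomposition lt M lam \<alpha>" "is_ideal_decomposition lt M lam \<beta>"
    then have "(\<lambda>K. real (\<alpha> K)) = (\<lambda>K. real (\<beta> K))"
      using real_ideal_decomposition_unique is_ideal_decomposition_real by blast
    then show "\<alpha> = \<beta>" by (simp add: fun_eq_iff)
  qed (rule ideal_decomposition_exists[OF assms])
qed

section \<open>Marked posets and chain-order polytopes with real markings\<close>

locale marked_poset =
  fixes P M C Om :: "'a::finite set" and lt lt' :: "'a \<Rightarrow> 'a \<Rightarrow> bool"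
  assumes irrefl: "irreflp_on P lt" and trans: "transp_on P lt"
    and M_subset: "M \<subseteq> P"
    and minimal: "minimal_elems lt P \<subseteq> M" and maximal: "maximal_elems lt P \<subseteq> M"
    and partition: "C \<union> Om = P - M" and disjoint: "C \<inter> Om = {}"
    and lt'_iff: "\<And>p q. p \<in> P \<Longrightarrow> q \<in> P \<Longrightarrow> lt' p q \<longleftrightarrow> lt p q \<and> p \<notin> M \<union> Om"
begin

lemma lt_irrefl: "p \<in> P \<Longrightarrow> \<not> lt p p"
  using irrefl by (auto simp: irreflp_on_def)

lemma lt_trans: "p \<in> P \<Longrightarrow> q \<in> P \<Longrightarrow> r \<in> P \<Longrightarrow> lt p q \<Longrightarrow> lt q r \<Longrightarrow> lt p r"
  using trans by (meson transp_onD)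

lemma P_eq: "P = M \<union> Om \<union> C"
  using M_subset partition by auto

lemma in_P: "p \<in> M \<Longrightarrow> p \<in> P" "p \<in> Om \<Longrightarrow> p \<in> P" "p \<in> C \<Longrightarrow> p \<in> P"
  using P_eq by auto

lemma C_not_M_Om: "p \<in> C \<Longrightarrow> p \<notin> M \<union> Om"
  using partition disjoint by auto

lemma acyclic_lt: "acyclic {(p, q). p \<in> P \<and> q \<in> P \<and> lt p q}"
proof -
  have "trans {(p, q). p \<in> P \<and> q \<in> P \<and> lt p q}"
    by (rule transI) (use lt_trans in blast)
  then show ?thesis using lt_irrefl by (auto simp: acyclic_def trancl_id)
qed

lemma wf_less: "wf {(p, q). p \<in> P \<and> q \<in> P \<and> lt p q}"
  by (rule finite_acyclic_wf[OF _ acyclic_lt]) simp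

lemma wf_greater: "wf {(q, p). p \<in> P \<and> q \<in> P \<and> lt p q}"
proof -
  have "{(q, p). p \<in> P \<and> q \<in> P \<and> lt p q} = {(p, q). p \<in> P \<and> q \<in> P \<and> lt p q}\<inverse>" by auto
  then show ?thesis using finite_acyclic_wf_converse[OF _ acyclic_lt] by simp
qed

text \<open>Climbing ends at a maximal element, which is marked. Since \<open>C\<close> misses
  \<open>M\<close>, this also puts something strictly above each element of \<open>C\<close>, so the
  maxima taken over larger elements are never empty.\<close>

lemma marked_above: "p \<in> P \<Longrightarrow> \<exists>m\<in>M. m = p \<or> lt p m"
proof (induction p rule: wf_induct[OF wf_greater])
  case (1 p)
  show ?case
  proof (cases "p \<in> maximal_elems lt P")
    case False
    then obtain q where q: "q \<in> P" "lt p q" using 1 by (auto simp: maximal_elems_def)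
    then obtain m where "m \<in> M" "m = q \<or> lt q m" using 1 by auto
    then show ?thesis using q 1(2) lt_trans M_subset by blast
  qed (use maximal in blast)
qed

lemma marked_below: "p \<in> P \<Longrightarrow> \<exists>m\<in>M. m = p \<or> lt m p"
proof (induction p rule: wf_induct[OF wf_less])
  case (1 p)
  show ?case
  proof (cases "p \<in> minimal_elems lt P")
    case False
    then obtain q where q: "q \<in> P" "lt q p" using 1 by (auto simp: minimal_elems_def)
    then obtain m where "m \<in> M" "m = q \<or> lt m q" using 1 by auto
    then show ?thesis using q 1(2) lt_trans M_subset by blast
  qed (use minimal in blast)
qed

text \<open>Markings are real so that the polytopes can be scaled and added, and so that an
  order-reversing real function on \<open>P\<close> can itself serve as the marking.\<close>

definition mco :: "('a \<Rightarrow> real) \<Rightarrow> (real ^ 'a) set" where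
  "mco l = {x. (\<forall>p. p \<notin> P \<longrightarrow> x $ p = 0) \<and>
         (\<forall>p\<in>M. x $ p = l p) \<and>
         (\<forall>p\<in>C. 0 \<le> x $ p) \<and>
         (\<forall>a \<in> M \<union> Om. \<forall>b \<in> M \<union> Om. \<forall>ps.
            set ps \<subseteq> C \<and> sorted_wrt lt (a # ps @ [b]) \<longrightarrow>
            (\<Sum>p\<leftarrow>ps. x $ p) \<le> x $ a - x $ b)}"

lemma marked_chain_order_polytope_eq_mco:
  "marked_chain_order_polytope P lt M C Om lam = mco (\<lambda>p. of_int (lam p))"
  by (simp add: marked_chain_order_polytope_def mco_def)

lemma mco_cong: "(\<And>p. p \<in> M \<Longrightarrow> l p = l' p) \<Longrightarrow> mco l = mco l'"
  by (simp add: mco_def)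

lemma mcoI:
  assumes "\<And>p. p \<notin> P \<Longrightarrow> x $ p = 0" "\<And>p. p \<in> M \<Longrightarrow> x $ p = l p" "\<And>p. p \<in> C \<Longrightarrow> 0 \<le> x $ p"
    and "\<And>a b ps. a \<in> M \<union> Om \<Longrightarrow> b \<in> M \<union> Om \<Longrightarrow> set ps \<subseteq> C \<Longrightarrow> sorted_wrt lt (a # ps @ [b]) \<Longrightarrow>
      (\<Sum>p\<leftarrow>ps. x $ p) \<le> x $ a - x $ b"
  shows "x \<in> mco l"
  unfolding mco_def using assms by blast

lemma mcoD:
  assumes "x \<in> mco l"
  shows "p \<notin> P \<Longrightarrow> x $ p = 0" "p \<in> M \<Longrightarrow> x $ p = l p" "p \<in> C \<Longrightarrow> 0 \<le> x $ p"
    and "a \<in> M \<union> Om \<Longrightarrow> b \<in> M \<union> Om \<Longrightarrow> set ps \<subseteq> C \<Longrightarrow> sorted_wrt lt (a # ps @ [b]) \<Longrightarrow>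
      (\<Sum>p\<leftarrow>ps. x $ p) \<le> x $ a - x $ b"
  using assms unfolding mco_def by blast+

text \<open>Every constraint is linear in the point and the marking jointly.\<close>

lemma mco_add:
  assumes "x \<in> mco l" "y \<in> mco l'"
  shows "x + y \<in> mco (\<lambda>p. l p + l' p)"
proof (rule mcoI)
  fix a b ps assume *: "a \<in> M \<union> Om" "b \<in> M \<union> Om" "set ps \<subseteq> C" "sorted_wrt lt (a # ps @ [b])"
  show "(\<Sum>p\<leftarrow>ps. (x + y) $ p) \<le> (x + y) $ a - (x + y) $ b"
    using mcoD(4)[OF assms(1) *] mcoD(4)[OF assms(2) *] by (simp add: sum_list_addf)
qed (use assms in \<open>simp_all add: mcoD\<close>)

lemma mco_scaleR:
  assumes "0 \<le> c" "x \<in> mco l"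
  shows "c *\<^sub>R x \<in> mco (\<lambda>p. c * l p)"
proof (rule mcoI)
  fix a b ps assume *: "a \<in> M \<union> Om" "b \<in> M \<union> Om" "set ps \<subseteq> C" "sorted_wrt lt (a # ps @ [b])"
  show "(\<Sum>p\<leftarrow>ps. (c *\<^sub>R x) $ p) \<le> (c *\<^sub>R x) $ a - (c *\<^sub>R x) $ b"
    using mult_left_mono[OF mcoD(4)[OF assms(2) *] assms(1)]
    by (simp add: sum_list_const_mult right_diff_distrib)
qed (use assms in \<open>simp_all add: mcoD\<close>)

lemma zero_in_mco: "0 \<in> mco (\<lambda>_. 0)"
  by (rule mcoI) (simp_all add: sum_list_0)

lemma mco_sum:
  "finite A \<Longrightarrow> (\<And>i. i \<in> A \<Longrightarrow> f i \<in> mco (l i)) \<Longrightarrow> sum f A \<in> mco (\<lambda>p. \<Sum>i\<in>A. l i p)"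
  by (induction A rule: finite_induct) (simp_all add: zero_in_mco mco_add)

lemma convex_mco: "convex (mco l)"
proof (rule convexI)
  fix x y :: "real ^ 'a" and u v :: real
  assume *: "x \<in> mco l" "y \<in> mco l" "0 \<le> u" "0 \<le> v" "u + v = 1"
  have "u *\<^sub>R x + v *\<^sub>R y \<in> mco (\<lambda>p. u * l p + v * l p)"
    by (intro mco_add mco_scaleR *)
  then show "u *\<^sub>R x + v *\<^sub>R y \<in> mco l"
    using * by (simp flip: distrib_right)
qed

section \<open>Transfer between order-reversing functions and points of the polytope\<close>

text \<open>
  The last conjunct says \<open>y p = x p - max {x q | q > p}\<close>.  As a relation it can be read in both
  directions, since \<open>x\<close> is recovered from \<open>y\<close> by recursion from the top of \<open>P\<close>.
\<close>

definition transfer :: "('a \<Rightarrow> real) \<Rightarrow> real ^ 'a \<Rightarrow> bool" where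
  "transfer x y \<longleftrightarrow>
     (\<forall>p\<in>P. \<forall>q\<in>P. lt p q \<longrightarrow> x q \<le> x p) \<and>
     (\<forall>p. p \<notin> P \<longrightarrow> y $ p = 0) \<and>
     (\<forall>p\<in>M \<union> Om. y $ p = x p) \<and>
     (\<forall>p\<in>C. (\<forall>q\<in>P. lt p q \<longrightarrow> y $ p \<le> x p - x q) \<and> (\<exists>q\<in>P. lt p q \<and> y $ p = x p - x q))"

lemma transferD:
  assumes "transfer x y"
  shows "p \<in> P \<Longrightarrow> q \<in> P \<Longrightarrow> lt p q \<Longrightarrow> x q \<le> x p" "p \<notin> P \<Longrightarrow> y $ p = 0" "p \<in> M \<union> Om \<Longrightarrow> y $ p = x p"
    and "p \<in> C \<Longrightarrow> q \<in> P \<Longrightarrow> lt p q \<Longrightarrow> y $ p \<le> x p - x q"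
    and "p \<in> C \<Longrightarrow> \<exists>q\<in>P. lt p q \<and> y $ p = x p - x q"
  using assms unfolding transfer_def by blast+

text \<open>Along a chain each \<open>y $ p\<close> is at most the drop of \<open>x\<close> from
  \<open>p\<close> to the next element, so the sum telescopes. The remaining comparison with
  \<open>a\<close> is order reversal of \<open>x\<close>.\<close>

lemma transfer_in_mco:
  assumes t: "transfer x y"
  shows "y \<in> mco x"
proof -
  \<comment> \<open>The head of \<open>ps @ [b]\<close> is the first element of the chain, and is
    \<open>b\<close> for the empty chain.\<close>
  have chain: "(\<Sum>p\<leftarrow>ps. y $ p) \<le> x (hd (ps @ [b])) - x b"
    if "b \<in> P" "set ps \<subseteq> C" "sorted_wrt lt (ps @ [b])" for b ps
    using that
  proof (induction ps)
    case (Cons p ps)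
    define q where "q = hd (ps @ [b])"
    have p: "p \<in> C" using Cons.prems by simp
    have "q \<in> set (ps @ [b])" unfolding q_def by (rule hd_in_set) simp
    then have q: "q \<in> P" "lt p q" using Cons.prems in_P(3) by auto
    have "y $ p \<le> x p - x q" using transferD(4)[OF t p q] .
    moreover have "(\<Sum>p\<leftarrow>ps. y $ p) \<le> x q - x b" using Cons by (simp add: q_def)
    ultimately show ?case by simp
  qed simp
  have "(\<Sum>p\<leftarrow>ps. y $ p) \<le> y $ a - y $ b"
    if "a \<in> M \<union> Om" "b \<in> M \<union> Om" "set ps \<subseteq> C" "sorted_wrt lt (a # ps @ [b])" for a b ps
  proof -
    define h where "h = hd (ps @ [b])"
    have h: "h \<in> set (ps @ [b])" unfolding h_def by (rule hd_in_set) simp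
    have "b \<in> P" using that(2) in_P by blast
    have "x h \<le> x a"
    proof (rule transferD(1)[OF t])
      show "a \<in> P" using that(1) in_P by blast
      show "h \<in> P" using that(3) h in_P \<open>b \<in> P\<close> by auto
      show "lt a h" using that(4) h by auto
    qed
    moreover have "(\<Sum>p\<leftarrow>ps. y $ p) \<le> x h - x b"
      unfolding h_def by (rule chain[OF \<open>b \<in> P\<close> that(3)]) (use that(4) in simp)
    ultimately show ?thesis using transferD(3)[OF t that(1)] transferD(3)[OF t that(2)] by simp
  qed
  moreover have "0 \<le> y $ p" if p: "p \<in> C" for p
    using transferD(5)[OF t p] transferD(1)[OF t in_P(3)[OF p]] by force
  ultimately show ?thesis
    by (intro mcoI) (use transferD[OF t] in auto)
qed

text \<open>Elements of \<open>M\<close> and \<open>Om\<close> are below nothing in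
  \<open>lt'\<close>, so those in \<open>J\<close> are all maximal, as \<open>y = x\<close> demands.
  For \<open>p\<close> in \<open>C\<close>, if \<open>J\<close> has an element above
  \<open>p\<close>, then \<open>p\<close> is in \<open>J\<close> and the difference is 0; if not,
  the maximum above \<open>p\<close> is 0 and the difference is the indicator of \<open>J\<close> at
  \<open>p\<close>.\<close>

lemma transfer_indicator:
  assumes J: "J \<in> order_ideals P lt"
  shows "transfer (indicator J) (indicator_vec (maximal_elems lt' J))"
proof -
  have J': "J \<subseteq> P" using J by (rule order_ideals_subset)
  have max: "p \<in> maximal_elems lt' J \<longleftrightarrow> p \<in> J \<and> (p \<in> C \<longrightarrow> (\<forall>q\<in>J. \<not> lt p q))" for p
    using J' lt'_iff C_not_M_Om P_eq unfolding maximal_elems_def by blast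
  have above: "\<exists>q\<in>P. lt p q" if "p \<in> C" for p
    using marked_above[of p] that M_subset P_eq C_not_M_Om by blast
  have down: "p \<in> J" if "p \<in> P" "lt p q" "q \<in> J" for p q
    using order_ideals_down[OF J that(3,1,2)] .
  show ?thesis
    unfolding transfer_def
  proof (intro conjI ballI impI allI)
    fix p assume p: "p \<in> C"
    show "\<exists>q\<in>P. lt p q \<and> (indicator_vec (maximal_elems lt' J) :: real ^ 'a) $ p = indicator J p - indicator J q"
    proof (cases "\<exists>q\<in>J. lt p q")
      case True
      then obtain q where q: "q \<in> J" "lt p q" by blast
      then have "p \<in> J" using down in_P(3)[OF p] by blast
      then show ?thesis using q p J' by (intro bexI[of _ q]) (auto simp: indicator_vec_def max indicator_def)
    next
      case False
      obtain q where "q \<in> P" "lt p q" using above[OF p] by blast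
      then show ?thesis using False p
        by (intro bexI[of _ q]) (auto simp: indicator_vec_def max indicator_def)
    qed
  qed (use down J' C_not_M_Om in_P in \<open>auto simp: indicator_vec_def max indicator_def\<close>)
qed

lemma mco_imp_transfer:
  assumes y: "y \<in> mco l"
  shows "\<exists>x. transfer x y"
proof -
  let ?R = "{(q, p). p \<in> P \<and> q \<in> P \<and> lt p q}"
  define F where "F = (\<lambda>f p. if p \<in> C then y $ p + Max (f ` {q \<in> P. lt p q}) else y $ p)"
  define x where "x = wfrec ?R F"
  have x_eq: "x p = y $ p + Max (x ` {q \<in> P. lt p q})" if "p \<in> C" for p
  proof -
    have "x p = F (cut x ?R p) p" unfolding x_def by (rule wfrec[OF wf_greater])
    also have "\<dots> = y $ p + Max (cut x ?R p ` {q \<in> P. lt p q})" using that by (simp add: F_def)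
    also have "cut x ?R p ` {q \<in> P. lt p q} = x ` {q \<in> P. lt p q}"
      using that P_eq by (intro image_cong) (auto simp: cut_apply)
    finally show ?thesis .
  qed
  have x_M: "x p = y $ p" if "p \<notin> C" for p
    using that unfolding x_def by (subst wfrec[OF wf_greater]) (simp add: F_def)
  have x_ge: "y $ p + x q \<le> x p" if "p \<in> C" "q \<in> P" "lt p q" for p q
    unfolding x_eq[OF that(1)] using that by (intro add_left_mono Max_ge) auto
  have x_ex: "\<exists>q\<in>P. lt p q \<and> x p = y $ p + x q" if p: "p \<in> C" for p
  proof -
    have "{q \<in> P. lt p q} \<noteq> {}"
      using marked_above[of p] p M_subset P_eq C_not_M_Om by blast
    then have "Max (x ` {q \<in> P. lt p q}) \<in> x ` {q \<in> P. lt p q}" by (intro Max_in) auto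
    then show ?thesis using x_eq[OF p] by auto
  qed
  \<comment> \<open>\<open>x p\<close> is the value of a chain from \<open>p\<close>, so the chain inequalities bound it by \<open>y a\<close> for \<open>a < p\<close>.\<close>
  have attained: "p \<in> C \<longrightarrow> (\<exists>ps b. b \<in> M \<union> Om \<and> set ps \<subseteq> C \<and> sorted_wrt lt (p # ps @ [b]) \<and>
     x p = y $ p + (\<Sum>p\<leftarrow>ps. y $ p) + y $ b)" for p
  proof (induction p rule: wf_induct[OF wf_greater])
    case (1 p)
    show ?case
    proof
      assume p: "p \<in> C"
      then obtain q where q: "q \<in> P" "lt p q" "x p = y $ p + x q" using x_ex by blast
      show "\<exists>ps b. b \<in> M \<union> Om \<and> set ps \<subseteq> C \<and> sorted_wrt lt (p # ps @ [b]) \<and>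
        x p = y $ p + (\<Sum>p\<leftarrow>ps. y $ p) + y $ b"
      proof (cases "q \<in> C")
        case True
        then obtain ps b where *: "b \<in> M \<union> Om" "set ps \<subseteq> C" "sorted_wrt lt (q # ps @ [b])"
           "x q = y $ q + (\<Sum>p\<leftarrow>ps. y $ p) + y $ b"
          using 1 p q P_eq by blast
        have "lt p r" if "r \<in> set (ps @ [b])" for r
        proof (rule lt_trans[OF _ q(1) _ q(2)])
          show "p \<in> P" "r \<in> P" using p that * P_eq by auto
          show "lt q r" using that * by auto
        qed
        then show ?thesis using * q True
          by (intro exI[of _ "q # ps"] exI[of _ b]) auto
      next
        case False
        then show ?thesis using q x_M P_eq
          by (intro exI[of _ "[]"] exI[of _ q]) auto
      qed
    qed
  qed
  \<comment> \<open>For \<open>p\<close> in \<open>C\<close> this is nonnegativity of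
    \<open>y\<close>. Otherwise the chain whose value is \<open>x q\<close>, with \<open>q\<close>
    itself included when it is in \<open>C\<close>, also runs below from \<open>p\<close>, and its
    chain inequality gives the bound \<open>y $ p\<close>.\<close>
  have mono: "x q \<le> x p" if pq: "p \<in> P" "q \<in> P" "lt p q" for p q
  proof (cases "p \<in> C")
    case True
    then have "0 \<le> y $ p" by (rule mcoD(3)[OF y])
    then show ?thesis using x_ge[OF True pq(2,3)] by simp
  next
    case False
    then have p: "p \<in> M \<union> Om" using pq P_eq by auto
    obtain ps b where *: "b \<in> M \<union> Om" "set ps \<subseteq> C" "sorted_wrt lt (p # ps @ [b])"
      "x q = (\<Sum>p\<leftarrow>ps. y $ p) + y $ b"
    proof (cases "q \<in> C")
      case True
      then obtain ps b where *: "b \<in> M \<union> Om" "set ps \<subseteq> C" "sorted_wrt lt (q # ps @ [b])"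
           "x q = y $ q + (\<Sum>p\<leftarrow>ps. y $ p) + y $ b"
        using attained by blast
      have "lt p r" if "r \<in> set (ps @ [b])" for r
      proof (rule lt_trans[OF pq(1,2) _ pq(3)])
        show "r \<in> P" using that * P_eq by auto
        show "lt q r" using that * by auto
      qed
      then show ?thesis using * pq True that[of b "q # ps"] by auto
    next
      case False
      then show ?thesis using that[of q "[]"] pq x_M P_eq by auto
    qed
    have "(\<Sum>p\<leftarrow>ps. y $ p) \<le> y $ p - y $ b" by (rule mcoD(4)[OF y p *(1-3)])
    then show ?thesis using * x_M[OF False] by simp
  qed
  have "transfer x y"
    unfolding transfer_def
  proof (intro conjI ballI impI allI)
    fix p assume p: "p \<in> C"
    show "\<exists>q\<in>P. lt p q \<and> y $ p = x p - x q" using x_ex[OF p] by force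
    fix q assume "q \<in> P" "lt p q"
    then show "y $ p \<le> x p - x q" using x_ge[OF p] by force
  qed (use mono x_M[symmetric] C_not_M_Om mcoD(1)[OF y] in auto)
  then show ?thesis by blast
qed

section \<open>Fundamental polytopes and their Minkowski sum\<close>

abbreviation R :: "'a set \<Rightarrow> (real ^ 'a) set" where
  "R \<equiv> fundamental_relative_poset_polytope P lt lt' M"

lemma vertex_in_R: "J \<in> order_ideals P lt \<Longrightarrow> indicator_vec (maximal_elems lt' J) \<in> R (J \<inter> M)"
  unfolding fundamental_relative_poset_polytope_def by (rule hull_inc) blast

text \<open>By convexity it suffices to check the vertices, which are transfers of indicators of
  ideals \<open>J\<close>. The polytope sees such a marking only through
  \<open>J \<inter> M\<close>.\<close>

lemma R_subset_mco: "R K \<subseteq> mco (indicator K)"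
  unfolding fundamental_relative_poset_polytope_def
proof (rule hull_minimal[where S = convex, OF _ convex_mco], clarify)
  fix J assume J: "J \<in> order_ideals P lt"
  have "mco (indicator (J \<inter> M)) = mco (indicator J)"
    by (rule mco_cong) (simp add: indicator_def)
  then show "indicator_vec (maximal_elems lt' J) \<in> mco (indicator (J \<inter> M))"
    using transfer_in_mco[OF transfer_indicator[OF J]] by simp
qed

text \<open>The down-closure of \<open>K\<close> in \<open>P\<close> has trace \<open>K\<close> on
  \<open>M\<close>. This supplies points for the summands with coefficient zero.\<close>

lemma R_nonempty:
  assumes K: "K \<in> order_ideals M lt"
  shows "R K \<noteq> {}"
proof -
  define J where "J = {p \<in> P. \<exists>k\<in>K. p = k \<or> lt p k}"
  have KM: "K \<subseteq> M" using K by (rule order_ideals_subset)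
  have "J \<in> order_ideals P lt"
    using KM M_subset lt_trans unfolding order_ideals_def J_def by blast
  moreover have "J \<inter> M = K"
    using KM M_subset order_ideals_down[OF K] unfolding J_def by blast
  ultimately show ?thesis using vertex_in_R by blast
qed

text \<open>Induction on the size of the support \<open>J\<close> of \<open>x\<close>. Peeling
  \<open>v\<close> times the indicator of \<open>J\<close> from \<open>x\<close> peels
  \<open>v\<close> times a vertex of \<open>R K\<close> from \<open>y\<close>, where
  \<open>K = J \<inter> M\<close>, and lowers \<open>\<alpha> K\<close> by \<open>v\<close>. Several
  successive ideals may have the same trace \<open>K\<close>; their vertices are averaged into one
  point of \<open>R K\<close>.\<close>

lemma transfer_decomposition:
  assumes "transfer x y" "\<And>p. p \<in> P \<Longrightarrow> 0 \<le> x p" "real_ideal_decomposition lt M x \<alpha>"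
  shows "\<exists>r. (\<forall>K\<in>order_ideals M lt. r K \<in> R K) \<and> y = (\<Sum>K\<in>order_ideals M lt. \<alpha> K *\<^sub>R r K)"
  using assms
proof (induction "card {p \<in> P. 0 < x p}" arbitrary: x y \<alpha> rule: less_induct)
  case less
  note t = less.prems(1) and nn = less.prems(2) and d = less.prems(3)
  have mono: "x q \<le> x p" if "p \<in> P" "q \<in> P" "lt p q" for p q
    using t that by (auto simp: transfer_def)
  define J where "J = {p \<in> P. 0 < x p}"
  define K where "K = {p \<in> M. 0 < x p}"
  have J: "J \<in> order_ideals P lt"
    using mono by (force simp: order_ideals_def J_def)
  have K: "K \<in> order_ideals M lt"
    using mono M_subset by (force simp: order_ideals_def K_def)
  have JK: "J \<inter> M = K" using M_subset by (auto simp: J_def K_def)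
  have K_ne: "K \<noteq> {}" if "J \<noteq> {}"
  proof -
    from that obtain p where p: "p \<in> J" by blast
    then obtain m where "m \<in> M" "m = p \<or> lt m p" using marked_below by (auto simp: J_def)
    then show ?thesis using p mono[of m p] M_subset by (force simp: K_def J_def)
  qed
  txt \<open>Peel off the smallest positive multiple of the indicator of the support of \<open>x\<close>.\<close>
  show ?case
  proof (cases "J = {}")
    case True
    then have x0: "x p = 0" if "p \<in> P" for p using nn that by (force simp: J_def)
    have "y $ p = 0" for p
    proof (cases "p \<in> C")
      case True
      then show ?thesis using transferD(5)[OF t] x0 in_P by force
    next
      case False
      then have "p \<in> P \<Longrightarrow> p \<in> M \<union> Om" using P_eq by blast
      then show ?thesis using transferD(2,3)[OF t, of p] x0[of p] by metis
    qed
    then have "y = 0" by (simp add: vec_eq_iff)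
    have "real_ideal_decomposition lt M x (\<lambda>_. 0)"
      using x0 M_subset by (auto simp: real_ideal_decomposition_def chain_subset_def)
    then have "\<alpha> = (\<lambda>_. 0)" using d real_ideal_decomposition_unique by blast
    \<comment> \<open>All coefficients vanish, so any choice of points will do.\<close>
    then show ?thesis using \<open>y = 0\<close> R_nonempty
      by (intro exI[of _ "\<lambda>K. SOME r. r \<in> R K"]) (auto simp: some_in_eq)
  next
    case False
    define v where "v = Min (x ` J)"
    define u where "u = indicator_vec (maximal_elems lt' J)"
    have v_le: "v \<le> x p" if "p \<in> J" for p using that by (auto simp: v_def)
    have "v \<in> x ` J" using False by (auto simp: v_def intro!: Min_in)
    then obtain j where j: "j \<in> J" "x j = v" by blast
    have v: "0 < v" using j by (auto simp: J_def)
    have x0: "x p = 0" if "p \<in> P" "p \<notin> J" for p using that nn by (force simp: J_def)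
    obtain k where k: "k \<in> M" "0 < x k" "x k = \<alpha> K"
      using real_ideal_decomposition_top[OF d] K_ne[OF False] by (auto simp: K_def)
    \<comment> \<open>\<open>\<alpha> K\<close> is a value of \<open>x\<close> on \<open>J\<close>,
      hence at least the minimum \<open>v\<close>.\<close>
    have v_K: "v \<le> \<alpha> K" using v_le[of k] k M_subset by (auto simp: J_def)
    define x' where "x' = (\<lambda>p. x p - v * indicator J p)"
    define \<alpha>' where "\<alpha>' = \<alpha>(K := \<alpha> K - v)"
    have tu: "transfer (indicator J) u" unfolding u_def by (rule transfer_indicator[OF J])
    \<comment> \<open>The minimiser \<open>j\<close> leaves the support.\<close>
    have "{p \<in> P. 0 < x' p} \<subset> J"
      using j v x0 by (auto simp: x'_def indicator_def J_def split: if_splits)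
    then have "card {p \<in> P. 0 < x' p} < card {p \<in> P. 0 < x p}"
      unfolding J_def by (intro psubset_card_mono) auto
    moreover have "transfer x' (y - v *\<^sub>R u)"
      unfolding transfer_def
    proof (intro conjI ballI impI allI)
      fix p q assume pq: "p \<in> P" "q \<in> P" "lt p q"
      show "x' q \<le> x' p"
        using mono[OF pq] order_ideals_down[OF J _ pq(1,3)] x0[OF pq(2)] v_le[of p] nn[OF pq(1)]
        by (cases "p \<in> J"; cases "q \<in> J") (auto simp: x'_def)
    next
      fix p assume "p \<notin> P"
      then show "(y - v *\<^sub>R u) $ p = 0" using t tu by (simp add: transfer_def)
    next
      fix p assume "p \<in> M \<union> Om"
      then show "(y - v *\<^sub>R u) $ p = x' p" using t tu by (simp add: transfer_def x'_def)
    next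
      fix p assume p: "p \<in> C"
      then have pP: "p \<in> P" using P_eq by auto
      obtain q where q: "q \<in> P" "lt p q" "y $ p = x p - x q"
        using t p by (auto simp: transfer_def)
      have q_min: "x r \<le> x q" if "r \<in> P" "lt p r" for r
        using t p q that by (force simp: transfer_def)
      obtain q' where q': "q' \<in> P" "lt p q'" "u $ p = indicator J p - indicator J q'"
        using tu p by (auto simp: transfer_def)
      \<comment> \<open>The maximum of \<open>x\<close> above \<open>p\<close>, attained at
        \<open>q\<close>, and that of \<open>indicator J\<close>, attained at \<open>q'\<close>, are
        both attained at \<open>q\<close>: if \<open>q'\<close> is in the support \<open>J\<close>,
        so is \<open>q\<close>, because \<open>x q'\<close> is at most \<open>x q\<close>. This is
        why the transfer is linear on the peeling.\<close>
      have "indicator J q \<le> (indicator J q' :: real)"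
        using tu p q q' by (force simp: transfer_def)
      moreover have "q' \<in> J \<Longrightarrow> q \<in> J" using q_min[OF q'(1,2)] q by (auto simp: J_def)
      ultimately have qq: "indicator J q' = (indicator J q :: real)"
        by (auto simp: indicator_def split: if_splits)
      have eq: "(y - v *\<^sub>R u) $ p = x' p - x' q"
        using q(3) q'(3) qq by (simp add: x'_def right_diff_distrib)
      then show "\<exists>q\<in>P. lt p q \<and> (y - v *\<^sub>R u) $ p = x' p - x' q" using q by blast
      fix r assume r: "r \<in> P" "lt p r"
      have "r \<in> J \<Longrightarrow> q \<in> J" using q_min[OF r] q(1) by (auto simp: J_def)
      then have "x' r \<le> x' q"
        using q_min[OF r] v_le[of q] x0[OF r(1)] x0[OF q(1)]
        by (cases "r \<in> J"; cases "q \<in> J") (simp_all add: x'_def)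
      then show "(y - v *\<^sub>R u) $ p \<le> x' p - x' r" using eq by simp
    qed
    moreover have "0 \<le> x' p" if "p \<in> P" for p
      using v_le[of p] nn[OF that] by (simp add: x'_def indicator_def)
    moreover have "real_ideal_decomposition lt M x' \<alpha>'"
    proof -
      have "real_ideal_decomposition lt M (\<lambda>p. x p - v * indicator K p) \<alpha>'"
        unfolding \<alpha>'_def using v v_K K K_ne[OF False] by (intro real_ideal_decomposition_diff[OF d]) auto
      moreover have "x' p = x p - v * indicator K p" if "p \<in> M" for p
        using that by (simp add: x'_def indicator_def flip: JK)
      ultimately show ?thesis by (simp add: real_ideal_decomposition_def)
    qed
    ultimately obtain r where r: "\<forall>K\<in>order_ideals M lt. r K \<in> R K"
      "y - v *\<^sub>R u = (\<Sum>K\<in>order_ideals M lt. \<alpha>' K *\<^sub>R r K)"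
      using less.hyps by blast
    \<comment> \<open>The weights merge the peeled vertex \<open>u\<close> with the point
      \<open>r K\<close> of the remainder so that \<open>\<alpha> K\<close> times \<open>s\<close>
      is their total contribution; \<open>\<alpha> K\<close> is positive because it is at least
      \<open>v\<close>.\<close>
    define s where "s = ((\<alpha> K - v) / \<alpha> K) *\<^sub>R r K + (v / \<alpha> K) *\<^sub>R u"
    have "s \<in> R K"
      unfolding s_def
    proof (rule convexD)
      show "convex (R K)" by (simp add: fundamental_relative_poset_polytope_def)
      show "u \<in> R K" using vertex_in_R[OF J] by (simp add: u_def JK)
      show "(\<alpha> K - v) / \<alpha> K + v / \<alpha> K = 1" using v v_K by (simp flip: add_divide_distrib)
    qed (use r K v v_K in auto)
    have s: "\<alpha> K *\<^sub>R s = \<alpha>' K *\<^sub>R r K + v *\<^sub>R u"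
      using v v_K by (simp add: s_def \<alpha>'_def scaleR_add_right)
    have "y = (\<Sum>K\<in>order_ideals M lt. \<alpha>' K *\<^sub>R r K) + v *\<^sub>R u"
      using r(2) by (metis diff_add_cancel)
    also have "\<dots> = (\<Sum>L\<in>order_ideals M lt. \<alpha> L *\<^sub>R (r(K := s)) L)"
      using K by (simp add: sum.remove[of _ K] s \<alpha>'_def)
    finally show ?thesis using r(1) \<open>s \<in> R K\<close>
      by (intro exI[of _ "r(K := s)"]) auto
  qed
qed

lemma nonneg_relative_poset_polytope_eq_mco:
  assumes "dominant lt M lam" "\<And>p. p \<in> M \<Longrightarrow> 0 \<le> lam p"
  shows "nonneg_relative_poset_polytope P lt lt' M lam = mco (\<lambda>p. of_int (lam p))"
proof -
  define \<alpha> where "\<alpha> = (\<lambda>K. real (ideal_coeff lt M lam K))"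
  have d: "real_ideal_decomposition lt M (\<lambda>p. of_int (lam p)) \<alpha>"
    unfolding \<alpha>_def by (intro is_ideal_decomposition_real is_ideal_decomposition_ideal_coeff assms)
  have "y \<in> nonneg_relative_poset_polytope P lt lt' M lam \<longleftrightarrow>
     (\<exists>r. (\<forall>K\<in>order_ideals M lt. r K \<in> R K) \<and> y = (\<Sum>K\<in>order_ideals M lt. \<alpha> K *\<^sub>R r K))" for y
  proof -
    have "y \<in> nonneg_relative_poset_polytope P lt lt' M lam \<longleftrightarrow>
     (\<exists>f. (\<forall>K\<in>order_ideals M lt. f K \<in> (*\<^sub>R) (\<alpha> K) ` R K) \<and> y = sum f (order_ideals M lt))"
      unfolding nonneg_relative_poset_polytope_def \<alpha>_def
      by (subst set_sum_alt) auto
    also have "\<dots> \<longleftrightarrow> (\<exists>r. (\<forall>K\<in>order_ideals M lt. r K \<in> R K) \<and> y = (\<Sum>K\<in>order_ideals M lt. \<alpha> K *\<^sub>R r K))"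
      (is "?A \<longleftrightarrow> ?B")
    proof
      assume ?A
      then obtain f where f: "\<forall>K\<in>order_ideals M lt. \<exists>r. r \<in> R K \<and> f K = \<alpha> K *\<^sub>R r"
        "y = sum f (order_ideals M lt)" by blast
      obtain r where "\<forall>K\<in>order_ideals M lt. r K \<in> R K \<and> f K = \<alpha> K *\<^sub>R r K"
        using bchoice[OF f(1)] by blast
      then show ?B using f(2) by (intro exI[of _ r]) simp
    next
      assume ?B
      then obtain r where "\<forall>K\<in>order_ideals M lt. r K \<in> R K" "y = (\<Sum>K\<in>order_ideals M lt. \<alpha> K *\<^sub>R r K)"
        by blast
      then show ?A by (intro exI[of _ "\<lambda>K. \<alpha> K *\<^sub>R r K"]) auto
    qed
    finally show ?thesis .
  qed
  moreover have "y \<in> mco (\<lambda>p. of_int (lam p))"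
    if "\<forall>K\<in>order_ideals M lt. r K \<in> R K" "y = (\<Sum>K\<in>order_ideals M lt. \<alpha> K *\<^sub>R r K)" for y r
  proof -
    have "y \<in> mco (\<lambda>p. \<Sum>K\<in>order_ideals M lt. \<alpha> K * indicator K p)"
      unfolding that(2)
      by (intro mco_sum mco_scaleR) (use that R_subset_mco in \<open>auto simp: \<alpha>_def\<close>)
    also have "\<dots> = mco (\<lambda>p. of_int (lam p))"
      by (rule mco_cong) (use d in \<open>simp add: real_ideal_decomposition_def\<close>)
    finally show ?thesis .
  qed
  moreover have "\<exists>r. (\<forall>K\<in>order_ideals M lt. r K \<in> R K) \<and> y = (\<Sum>K\<in>order_ideals M lt. \<alpha> K *\<^sub>R r K)"
    if y: "y \<in> mco (\<lambda>p. of_int (lam p))" for y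
  proof -
    obtain x where t: "transfer x y" using mco_imp_transfer[OF y] ..
    have x: "x p = of_int (lam p)" if "p \<in> M" for p
      using t y that by (auto simp: transfer_def mco_def)
    \<comment> \<open>Nonnegativity passes down from a marked element above \<open>p\<close>, since
      \<open>x\<close> reverses the order.\<close>
    have "0 \<le> x p" if p: "p \<in> P" for p
    proof -
      obtain m where m: "m \<in> M" "m = p \<or> lt p m" using marked_above[OF p] by blast
      have "0 \<le> x m" using assms(2) x m by simp
      also have "x m \<le> x p" using t m p M_subset by (auto simp: transfer_def)
      finally show ?thesis .
    qed
    moreover have "real_ideal_decomposition lt M x \<alpha>"
      using d x by (simp add: real_ideal_decomposition_def)
    ultimately show ?thesis by (intro transfer_decomposition[OF t])
  qed
  ultimately show ?thesis by blast
qed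

section \<open>Shifting the marking to reach arbitrary integers\<close>

lemma mco_shift:
  "(\<lambda>x. x - c *\<^sub>R indicator_vec (maximal_elems lt' P)) ` mco (\<lambda>p. l p + c * indicator M p) = mco l"
proof -
  \<comment> \<open>The shift vector therefore vanishes on \<open>C\<close> and is 1 at both ends of
    every chain, so the chain inequalities do not change.\<close>
  have "maximal_elems lt' P = M \<union> Om"
  proof
    show "maximal_elems lt' P \<subseteq> M \<union> Om"
    proof
      fix p assume p: "p \<in> maximal_elems lt' P"
      then have "p \<in> P" by (simp add: maximal_elems_def)
      then obtain m where "m \<in> M" "m = p \<or> lt p m" using marked_above by blast
      then show "p \<in> M \<union> Om"
        using p \<open>p \<in> P\<close> lt'_iff M_subset by (auto simp: maximal_elems_def)
    qed
    show "M \<union> Om \<subseteq> maximal_elems lt' P"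
      using lt'_iff P_eq by (auto simp: maximal_elems_def)
  qed
  then have u: "indicator_vec (maximal_elems lt' P) $ p = (if p \<in> M \<union> Om then 1 else 0 :: real)" for p
    by (simp add: indicator_vec_def)
  let ?u = "indicator_vec (maximal_elems lt' P) :: real ^ 'a"
  \<comment> \<open>Stated for all \<open>l\<close> and all real \<open>c\<close>, so that
    \<open>-c\<close> gives the reverse inclusion.\<close>
  have sub: "x + c *\<^sub>R ?u \<in> mco (\<lambda>p. l p + c * indicator M p)" if x: "x \<in> mco l" for x l and c :: real
  proof -
    have eq: "(\<Sum>p\<leftarrow>ps. (x + c *\<^sub>R ?u) $ p) = (\<Sum>p\<leftarrow>ps. x $ p)" if "set ps \<subseteq> C" for ps
      using that C_not_M_Om by (intro arg_cong[where f = sum_list] map_cong) (auto simp: u)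
    show ?thesis
    proof (rule mcoI)
      fix a b ps assume *: "a \<in> M \<union> Om" "b \<in> M \<union> Om" "set ps \<subseteq> C" "sorted_wrt lt (a # ps @ [b])"
      show "(\<Sum>p\<leftarrow>ps. (x + c *\<^sub>R ?u) $ p) \<le> (x + c *\<^sub>R ?u) $ a - (x + c *\<^sub>R ?u) $ b"
        unfolding eq[OF *(3)] using mcoD(4)[OF x *] *(1,2) by (simp add: u)
    qed (use mcoD[OF x] C_not_M_Om in_P in \<open>auto simp: u\<close>)
  qed
  have "x - c *\<^sub>R ?u \<in> mco l" if "x \<in> mco (\<lambda>p. l p + c * indicator M p)" for x
    using sub[OF that, of "-c"] by simp
  moreover have "x \<in> (\<lambda>x. x - c *\<^sub>R ?u) ` mco (\<lambda>p. l p + c * indicator M p)" if "x \<in> mco l" for x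
    by (rule image_eqI[of _ _ "x + c *\<^sub>R ?u"]) (use sub[OF that] in auto)
  ultimately show ?thesis by blast
qed

text \<open>Each admissible \<beta> yields the same chain-order polytope, so that set satisfies the
  definite description. One admissible \<beta> suffices to exclude any other set.\<close>

lemma relative_poset_polytope_eq:
  assumes "dominant lt M lam"
  shows "relative_poset_polytope P lt lt' M lam = marked_chain_order_polytope P lt M C Om lam"
proof -
  have shifted: "(\<lambda>x. x - of_int \<beta> *\<^sub>R indicator_vec (maximal_elems lt' P)) `
      nonneg_relative_poset_polytope P lt lt' M (\<lambda>p. lam p + \<beta> * indicator M p) =
      marked_chain_order_polytope P lt M C Om lam"
    if "\<forall>p\<in>M. 0 \<le> lam p + \<beta> * indicator M p" for \<beta> :: int
  proof -
    have "dominant lt M (\<lambda>p. lam p + \<beta> * indicator M p)"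
      using assms by (auto simp: dominant_def)
    then have "nonneg_relative_poset_polytope P lt lt' M (\<lambda>p. lam p + \<beta> * indicator M p) =
        mco (\<lambda>p. of_int (lam p + \<beta> * indicator M p))"
      using that by (intro nonneg_relative_poset_polytope_eq_mco) auto
    also have "\<dots> = mco (\<lambda>p. of_int (lam p) + of_int \<beta> * indicator M p)"
      by (rule mco_cong) simp
    finally show ?thesis by (simp add: mco_shift marked_chain_order_polytope_eq_mco)
  qed
  obtain \<beta> :: int where \<beta>: "\<forall>p\<in>M. 0 \<le> lam p + \<beta> * indicator M p"
  proof
    \<comment> \<open>The sum of the absolute values of the marking dominates each of its
      entries.\<close>
    show "\<forall>p\<in>M. 0 \<le> lam p + (\<Sum>q\<in>M. \<bar>lam q\<bar>) * indicator M p"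
    proof
      fix p assume "p \<in> M"
      then have "\<bar>lam p\<bar> \<le> (\<Sum>q\<in>M. \<bar>lam q\<bar>)" by (intro member_le_sum) auto
      then show "0 \<le> lam p + (\<Sum>q\<in>M. \<bar>lam q\<bar>) * indicator M p" using \<open>p \<in> M\<close> by simp
    qed
  qed
  show ?thesis
    unfolding relative_poset_polytope_def
    by (rule the_equality) (use shifted \<beta> in auto)
qed

end

theorem theorem3p5p5:
  fixes P Pstar C Om :: "'a::finite set"
    and lt lt' :: "'a \<Rightarrow> 'a \<Rightarrow> bool"
    and lam :: "'a \<Rightarrow> int"
  assumes "irreflp_on P lt" and "transp_on P lt"
    and "Pstar \<subseteq> P"
    and "minimal_elems lt P \<subseteq> Pstar" and "maximal_elems lt P \<subseteq> Pstar"
    and "dominant lt Pstar lam"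
    and "C \<union> Om = P - Pstar" and "C \<inter> Om = {}"
    and "\<And>p q. p \<in> P \<Longrightarrow> q \<in> P \<Longrightarrow> lt' p q \<longleftrightarrow> lt p q \<and> p \<notin> Pstar \<union> Om"
  shows "marked_chain_order_polytope P lt Pstar C Om lam = relative_poset_polytope P lt lt' Pstar lam"
proof -
  interpret marked_poset P Pstar C Om lt lt'
    using assms by unfold_locales auto
  show ?thesis using relative_poset_polytope_eq[OF assms(6)] by simp
qed

end
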